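(* Consider the $(n-k)$-form on $\mathbb C^{n-k+1}$ $$\Omega=\sum_{j=0}^{n-k}(-1)^j\lambda_jx_j\,dx_0\wedge\dots\wedge\widehat{dx_j}\wedge\dots\wedge dx_{n-k},\qquad \lambda_j\in\mathbb N,\ \lambda_i\ne\lambda_j\text{ for } i\ne j,$$ and let $\Lambda_{NR}=\{\lambda_0<\dots<\lambda_\ell\}$ and $\Lambda_R=\{\lambda_{\ell+1}<\dots<\lambda_{n-k}\}$ be the non-resonant part and the resonant part of the set of eigenvalues, respectively. Let $\mathbf m_{\ell+s}\in R(s)$ for $s=1,\dots,n-k-\ell$, let $\mathbf M=(\mathbf m_{\ell+1},\dots,\mathbf m_{n-k})$ and $H_{\mathbf M}=h^{\ell+1}_{\mathbf m_{\ell+1}}\cdots h^{n-k}_{\mathbf m_{n-k}}$. Then $x_0\cdots x_\ell H_{\mathbf M}(x_0,\dots,x_\ell)$ is an integrating factor of $\Omega$, and $$\frac{\Omega}{x_0\cdots x_\ell\,H_{\mathbf M}(x_0,\dots,x_\ell)}=\eta_{NR}\wedge d\varphi^{\ell+1}_{\mathbf m_{\ell+1}}\wedge\dots\wedge d\varphi^{n-k}_{\mathbf m_{n-k}}.$$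
   Context: Here $\mathbb N$ denotes the positive integers (for the $\lambda_j$). A finite set of positive integers is resonant if some element $\lambda_s$ of it can be written $\lambda_s=\sum_jm_j\lambda_j$ with $\lambda_j$ in the set, integers $m_j\ge0$ and $\sum m_j\ge2$; otherwise it is non-resonant. The eigenvalues are labelled so that $\Lambda_{NR}=\{\lambda_0<\dots<\lambda_\ell\}$ is non-resonant and maximal with this property, contains the smallest eigenvalue, and every eigenvalue of the complement $\Lambda_R=\{\lambda_{\ell+1}<\dots<\lambda_{n-k}\}$ has a resonance relation involving only elements of $\Lambda_{NR}$: $\lambda_{\ell+s}=m_0\lambda_0+\dots+m_\ell\lambda_\ell$ with $m_j\ge0$ integers, $\sum m_j\ge2$. For $s=1,\dots,n-k-\ell$ put $$R(s)=\left\{\mathbf m=(m_0,\dots,m_\ell)\in\mathbb Z_{\ge0}^{\ell+1}:\ m_0\lambda_0+\dots+m_\ell\lambda_\ell=\lambda_{\ell+s}\right\},$$ and for $\mathbf m\in R(s)$ $$h^{\ell+s}_{\mathbf m}(x_0,\dots,x_\ell)=x_0^{m_0}\cdots x_\ell^{m_\ell},\qquad \varphi^{\ell+s}_{\mathbf m}=\frac{x_{\ell+s}}{h^{\ell+s}_{\mathbf m}(x_0,\dots,x_\ell)}.$$ The logarithmic non-resonant part is the $\ell$-form $$\eta_{NR}=\sum_{j=0}^{\ell}(-1)^j\lambda_j\frac{dx_0}{x_0}\wedge\dots\wedge\widehat{\frac{dx_j}{x_j}}\wedge\dots\wedge\frac{dx_\ell}{x_\ell}.$$ An integrating factor of $\Omega$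 is a function $\psi$ such that $\Omega/\psi$ is a closed meromorphic (integrable) form. *)

theory Defs
  imports "HOL-Analysis.Analysis" "HOL-Library.Function_Algebras"
begin

section \<open>Functions on \<open>\<complex>\<^sup>N\<close>\<close>

text \<open>A point of \<open>\<complex>\<^sup>N\<close> is a function with coordinates \<open>x 0, \<dots>, x (N - 1)\<close>, in the extensional
  representation \<open>{..<N} \<rightarrow>\<^sub>E UNIV\<close> (the carrier of the product topology below).\<close>

abbreviation complex_space :: "nat \<Rightarrow> (nat \<Rightarrow> complex) topology" where
  "complex_space N \<equiv> product_topology (\<lambda>_. euclidean) {..<N}"

text \<open>Holomorphy in several variables: continuous and complex differentiable in each variable.\<close>

definition holomorphic_in :: "nat \<Rightarrow> (nat \<Rightarrow> complex) set \<Rightarrow> ((nat \<Rightarrow> complex) \<Rightarrow> complex) \<Rightarrow> bool" where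
  "holomorphic_in N U f \<longleftrightarrow>
     openin (complex_space N) U \<and>
     continuous_map (subtopology (complex_space N) U) euclidean f \<and>
     (\<forall>x\<in>U. \<forall>k<N. (\<lambda>t. f (x(k := t))) field_differentiable (at (x k)))"

definition generically_nonzero :: "nat \<Rightarrow> (nat \<Rightarrow> complex) set \<Rightarrow> ((nat \<Rightarrow> complex) \<Rightarrow> complex) \<Rightarrow> bool" where
  "generically_nonzero N U g \<longleftrightarrow>
     (\<forall>V. openin (complex_space N) V \<and> V \<subseteq> U \<and> V \<noteq> {} \<longrightarrow> (\<exists>x\<in>V. g x \<noteq> 0))"

text \<open>A meromorphic function is represented by a total function which is locally a quotient of
  holomorphic functions; its values on the zero set of the denominator are irrelevant.\<close>

definition meromorphic_fun :: "nat \<Rightarrow> ((nat \<Rightarrow> complex) \<Rightarrow> complex) \<Rightarrow> bool" where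
  "meromorphic_fun N F \<longleftrightarrow>
     (\<forall>p\<in>topspace (complex_space N). \<exists>U f g. p \<in> U \<and>
        holomorphic_in N U f \<and> holomorphic_in N U g \<and> generically_nonzero N U g \<and>
        (\<forall>x\<in>U. g x \<noteq> 0 \<longrightarrow> F x = f x / g x))"


section \<open>Differential forms on \<open>\<complex>\<^sup>N\<close>\<close>

text \<open>The family \<open>\<omega>\<close> stands for \<open>\<Sum>I. \<omega> I dx\<^sub>I\<close>, where \<open>dx\<^sub>I = dx\<^sub>i\<^sub>1 \<and> \<dots> \<and> dx\<^sub>i\<^sub>p\<close> for
  \<open>I = {i\<^sub>1 < \<dots> < i\<^sub>p} \<subseteq> {..<N}\<close>. Sums of forms are those of Function_Algebras.\<close>

type_synonym dform = "nat set \<Rightarrow> (nat \<Rightarrow> complex) \<Rightarrow> complex"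

definition fun_form :: "((nat \<Rightarrow> complex) \<Rightarrow> complex) \<Rightarrow> dform" where
  "fun_form f I x = (if I = {} then f x else 0)"

definition dx :: "nat \<Rightarrow> dform" where
  "dx i I x = (if I = {i} then 1 else 0)"

definition fscale :: "((nat \<Rightarrow> complex) \<Rightarrow> complex) \<Rightarrow> dform \<Rightarrow> dform" (infixr "*\<^sub>f" 75) where
  "(f *\<^sub>f \<omega>) I x = f x * \<omega> I x"

definition fdivide :: "dform \<Rightarrow> ((nat \<Rightarrow> complex) \<Rightarrow> complex) \<Rightarrow> dform" (infixl "'/\<^sub>f" 70) where
  "(\<omega> /\<^sub>f f) I x = \<omega> I x / f x"

text \<open>For disjoint \<open>I\<close>, \<open>J\<close> this is the sign with \<open>dx\<^sub>I \<and> dx\<^sub>J = shuffle_sign I J dx\<^bsub>I \<union> J\<^esub>\<close>.\<close>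

definition shuffle_sign :: "nat set \<Rightarrow> nat set \<Rightarrow> complex" where
  "shuffle_sign I J = (- 1) ^ card {(i, j). i \<in> I \<and> j \<in> J \<and> j < i}"

definition wedge :: "dform \<Rightarrow> dform \<Rightarrow> dform" (infixr "\<and>\<^sub>f" 72) where
  "(\<alpha> \<and>\<^sub>f \<beta>) K x = (\<Sum>I\<in>Pow K. shuffle_sign I (K - I) * \<alpha> I x * \<beta> (K - I) x)"

definition wedges :: "dform list \<Rightarrow> dform" where
  "wedges \<alpha>s = foldr (\<and>\<^sub>f) \<alpha>s (fun_form (\<lambda>x. 1))"

definition partial :: "nat \<Rightarrow> ((nat \<Rightarrow> complex) \<Rightarrow> complex) \<Rightarrow> (nat \<Rightarrow> complex) \<Rightarrow> complex" where
  "partial k f x = deriv (\<lambda>t. f (x(k := t))) (x k)"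

text \<open>\<open>d (\<Sum>I. \<omega> I dx\<^sub>I) = \<Sum>I. \<Sum>k<N. \<partial>(\<omega> I)/\<partial>x\<^sub>k dx\<^sub>k \<and> dx\<^sub>I\<close>, collected by \<open>K = insert k I\<close>.\<close>

definition ext_d :: "nat \<Rightarrow> dform \<Rightarrow> dform" where
  "ext_d N \<omega> K x =
     (if K \<subseteq> {..<N} then \<Sum>k\<in>K. shuffle_sign {k} (K - {k}) * partial k (\<omega> (K - {k})) x else 0)"

text \<open>Contraction with the constant multivector \<open>e\<^sub>J\<close>, i.e. \<open>\<omega>(e\<^sub>j\<^sub>1, \<dots>, e\<^sub>j\<^sub>r, \<cdot>)\<close> for
  \<open>J = {j\<^sub>1 < \<dots> < j\<^sub>r}\<close>.\<close>

definition contract :: "nat set \<Rightarrow> dform \<Rightarrow> dform" where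
  "contract J \<omega> I x = (if J \<inter> I = {} then shuffle_sign J I * \<omega> (J \<union> I) x else 0)"


definition meromorphic_form :: "nat \<Rightarrow> nat \<Rightarrow> dform \<Rightarrow> bool" where
  "meromorphic_form N q \<omega> \<longleftrightarrow>
     (\<forall>I. if I \<subseteq> {..<N} \<and> card I = q then meromorphic_fun N (\<omega> I)
          else (\<forall>x\<in>topspace (complex_space N). \<omega> I x = 0))"

text \<open>For a meromorphic form the points where (the representing functions of) all coefficients are
  holomorphic are dense, and identities between such forms are understood at these points.\<close>

definition regular_points :: "nat \<Rightarrow> dform \<Rightarrow> (nat \<Rightarrow> complex) set" where
  "regular_points N \<omega> = {p. \<exists>U. p \<in> U \<and> (\<forall>I. holomorphic_in N U (\<omega> I))}"

definition closed_form :: "nat \<Rightarrow> dform \<Rightarrow> bool" where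
  "closed_form N \<omega> \<longleftrightarrow> (\<forall>x\<in>regular_points N \<omega>. \<forall>K. ext_d N \<omega> K x = 0)"

text \<open>Integrability of a \<open>q\<close>-form: \<open>(i\<^sub>v \<omega>) \<and> \<omega> = 0\<close> and \<open>(i\<^sub>v \<omega>) \<and> d\<omega> = 0\<close> for all \<open>(q - 1)\<close>-vectors
  \<open>v\<close>. By linearity it suffices to take \<open>v = e\<^sub>J\<close>; for \<open>q = 0\<close> there is no condition.\<close>

definition integrable_form :: "nat \<Rightarrow> nat \<Rightarrow> dform \<Rightarrow> bool" where
  "integrable_form N q \<omega> \<longleftrightarrow>
     (\<forall>J. J \<subseteq> {..<N} \<and> Suc (card J) = q \<longrightarrow>
        (\<forall>x\<in>regular_points N \<omega>. \<forall>K.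
           (contract J \<omega> \<and>\<^sub>f \<omega>) K x = 0 \<and> (contract J \<omega> \<and>\<^sub>f ext_d N \<omega>) K x = 0))"

text \<open>Generic nonvanishing of \<open>\<psi>\<close> is what makes \<open>\<Omega>/\<psi>\<close> meaningful: in HOL, division by \<open>0\<close> gives \<open>0\<close>.\<close>

definition integrating_factor :: "nat \<Rightarrow> nat \<Rightarrow> dform \<Rightarrow> ((nat \<Rightarrow> complex) \<Rightarrow> complex) \<Rightarrow> bool" where
  "integrating_factor N q \<Omega> \<psi> \<longleftrightarrow>
     generically_nonzero N (topspace (complex_space N)) \<psi> \<and>
     meromorphic_form N q (\<Omega> /\<^sub>f \<psi>) \<and> closed_form N (\<Omega> /\<^sub>f \<psi>) \<and> integrable_form N q (\<Omega> /\<^sub>f \<psi>)"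


section \<open>Resonances and logarithmic forms\<close>

definition resonant :: "nat set \<Rightarrow> bool" where
  "resonant S \<longleftrightarrow> (\<exists>s\<in>S. \<exists>m :: nat \<Rightarrow> nat. s = (\<Sum>j\<in>S. m j * j) \<and> 2 \<le> (\<Sum>j\<in>S. m j))"

definition resonances :: "(nat \<Rightarrow> nat) \<Rightarrow> nat \<Rightarrow> nat \<Rightarrow> (nat \<Rightarrow> nat) set" where
  "resonances lam l s = {m \<in> {..l} \<rightarrow>\<^sub>E UNIV. (\<Sum>j\<le>l. m j * lam j) = lam (l + s)}"

definition h_monom :: "nat \<Rightarrow> (nat \<Rightarrow> nat) \<Rightarrow> (nat \<Rightarrow> complex) \<Rightarrow> complex" where
  "h_monom l m x = (\<Prod>j\<le>l. x j ^ m j)"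

definition phi :: "nat \<Rightarrow> nat \<Rightarrow> (nat \<Rightarrow> nat) \<Rightarrow> (nat \<Rightarrow> complex) \<Rightarrow> complex" where
  "phi l i m x = x i / h_monom l m x"

definition H_prod :: "nat \<Rightarrow> nat \<Rightarrow> (nat \<Rightarrow> nat \<Rightarrow> nat) \<Rightarrow> (nat \<Rightarrow> complex) \<Rightarrow> complex" where
  "H_prod d l M x = (\<Prod>i\<in>{l<..d}. h_monom l (M i) x)"

definition omit :: "nat \<Rightarrow> nat \<Rightarrow> nat list" where
  "omit d j = filter (\<lambda>i. i \<noteq> j) [0..<Suc d]"

definition Omega_form :: "nat \<Rightarrow> (nat \<Rightarrow> nat) \<Rightarrow> dform" where
  "Omega_form d lam =
     (\<Sum>j\<le>d. (\<lambda>x. (- 1) ^ j * of_nat (lam j) * x j) *\<^sub>f wedges (map dx (omit d j)))"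

definition eta_NR :: "nat \<Rightarrow> (nat \<Rightarrow> nat) \<Rightarrow> dform" where
  "eta_NR l lam =
     (\<Sum>j\<le>l. (\<lambda>x. (- 1) ^ j * of_nat (lam j)) *\<^sub>f
        wedges (map (\<lambda>i. dx i /\<^sub>f (\<lambda>x. x i)) (omit l j)))"

end

theory Submission
  imports Defs
begin

text \<open>Write \<open>d = n - k\<close>, and let \<open>v = \<Sum>j\<le>d. \<lambda>\<^sub>j x\<^sub>j \<partial>/\<partial>x\<^sub>j\<close> be the linear vector field with the given
  eigenvalues. Then \<open>\<Omega>\<close> is the contraction of \<open>v\<close> with the volume form \<open>dx\<^sub>0 \<and> \<dots> \<and> dx\<^sub>d\<close>, and
  \<open>\<eta>\<^sub>N\<^sub>R\<close> is the contraction of \<open>v\<close> with \<open>dx\<^sub>0 \<and> \<dots> \<and> dx\<^sub>l\<close>, divided by \<open>x\<^sub>0 \<cdots> x\<^sub>l\<close>. Both are therefore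
  values of a single family \<open>vol_contraction\<close>.

  The product formula rests on one fact of multilinear algebra (\<open>vol_contraction_wedge_one_form\<close>): if
  a one-form \<open>\<theta>\<close> in \<open>dx\<^sub>0, \<dots>, dx\<^sub>p\<^sub>+\<^sub>1\<close> annihilates \<open>v\<close>, then wedging the contraction of \<open>v\<close> with
  \<open>dx\<^sub>0 \<and> \<dots> \<and> dx\<^sub>p\<close> by \<open>\<theta>\<close> gives \<open>\<theta>\<^sub>p\<^sub>+\<^sub>1\<close> times the contraction of \<open>v\<close> with \<open>dx\<^sub>0 \<and> \<dots> \<and> dx\<^sub>p\<^sub>+\<^sub>1\<close>.
  The resonance relation says precisely that \<open>x\<^sub>i\<close> and its resonant monomial have the same weight
  under \<open>v\<close>, so that their quotient \<open>\<phi>\<close> is a first integral, \<open>d\<phi>(v) = 0\<close> (\<open>euler_phi\<close>). The coefficient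
  of \<open>dx\<^sub>i\<close> in \<open>d\<phi>\<close> is the inverse of that monomial, and wedging by the \<open>d\<phi>\<close> one after the other
  (\<open>eta_wedge_d_phi\<close>) accumulates the denominator \<open>\<psi> = x\<^sub>0 \<cdots> x\<^sub>l H\<close>.

  For the integrating factor, \<open>\<psi>\<close> is itself a monomial in \<open>x\<^sub>0, \<dots>, x\<^sub>l\<close>. The form \<open>\<Omega>/\<psi>\<close> is closed
  iff the vector field \<open>v/\<psi>\<close> has divergence zero, that is, iff the weight of \<open>\<psi>\<close> equals the trace
  \<open>\<Sum>j\<le>d. \<lambda>\<^sub>j\<close> of \<open>v\<close> (\<open>ext_d_vol_contraction\<close>). The factors \<open>x\<^sub>0, \<dots>, x\<^sub>l\<close> contribute the eigenvalues
  of the non-resonant part, and, again by resonance, the factors of \<open>H\<close> contribute the others.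
  Contractions of a vector with a volume form are decomposable, which gives the algebraic
  integrability condition (\<open>contract_vol_contraction_wedge\<close>).

  This calculus takes place where \<open>\<psi>\<close> does not vanish. It covers every regular point, since near a
  zero of some \<open>x\<^sub>i\<close>, \<open>i \<le> l\<close>, the coefficient of \<open>\<Omega>/\<psi>\<close> at the index set without \<open>i\<close> fails to be
  continuous (\<open>regular_points_nonzero\<close>).\<close>

section \<open>Shuffle signs\<close>

lemma shuffle_sign_singleton_left: "shuffle_sign {k} B = (- 1) ^ card {b \<in> B. b < k}"
proof -
  have "{(i, j). i \<in> {k} \<and> j \<in> B \<and> j < i} = Pair k ` {b \<in> B. b < k}" by auto
  then show ?thesis by (simp add: shuffle_sign_def card_image inj_on_def)
qed

lemma shuffle_sign_singleton_right: "shuffle_sign A {k} = (- 1) ^ card {a \<in> A. k < a}"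
proof -
  have "{(i, j). i \<in> A \<and> j \<in> {k} \<and> j < i} = (\<lambda>a. (a, k)) ` {a \<in> A. k < a}" by auto
  then show ?thesis by (simp add: shuffle_sign_def card_image inj_on_def)
qed

lemma shuffle_sign_empty [simp]: "shuffle_sign {} J = 1" "shuffle_sign I {} = 1"
  by (simp_all add: shuffle_sign_def)

lemma finite_inversions:
  assumes "finite A" "finite B"
  shows "finite {(i, j). i \<in> A \<and> j \<in> B \<and> j < i}"
  by (rule finite_subset[OF _ finite_cartesian_product[OF assms]]) auto

lemma shuffle_sign_Un_left:
  assumes "finite A" "finite B" "finite C" "A \<inter> B = {}"
  shows "shuffle_sign (A \<union> B) C = shuffle_sign A C * shuffle_sign B C"
proof -
  have "{(i, j). i \<in> A \<union> B \<and> j \<in> C \<and> j < i} =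
      {(i, j). i \<in> A \<and> j \<in> C \<and> j < i} \<union> {(i, j). i \<in> B \<and> j \<in> C \<and> j < i}"
    by auto
  moreover have "{(i, j). i \<in> A \<and> j \<in> C \<and> j < i} \<inter> {(i, j). i \<in> B \<and> j \<in> C \<and> j < i} = {}"
    using assms(4) by auto
  ultimately show ?thesis
    using assms by (simp add: shuffle_sign_def card_Un_disjoint finite_inversions power_add)
qed

lemma shuffle_sign_Un_right:
  assumes "finite A" "finite B" "finite C" "B \<inter> C = {}"
  shows "shuffle_sign A (B \<union> C) = shuffle_sign A B * shuffle_sign A C"
proof -
  have "{(i, j). i \<in> A \<and> j \<in> B \<union> C \<and> j < i} =
      {(i, j). i \<in> A \<and> j \<in> B \<and> j < i} \<union> {(i, j). i \<in> A \<and> j \<in> C \<and> j < i}"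
    by auto
  moreover have "{(i, j). i \<in> A \<and> j \<in> B \<and> j < i} \<inter> {(i, j). i \<in> A \<and> j \<in> C \<and> j < i} = {}"
    using assms(4) by auto
  ultimately show ?thesis
    using assms by (simp add: shuffle_sign_def card_Un_disjoint finite_inversions power_add)
qed

lemma shuffle_sign_singleton_atMost:
  assumes "k \<le> p"
  shows "shuffle_sign {k} ({..p} - {k}) = (- 1) ^ k"
proof -
  have "{b \<in> {..p} - {k}. b < k} = {..<k}" using assms by auto
  then show ?thesis by (simp add: shuffle_sign_singleton_left)
qed

lemma shuffle_sign_atMost_singleton: "shuffle_sign ({..p} - {k}) {k} = (- 1) ^ (p - k)"
proof -
  have "{a \<in> {..p} - {k}. k < a} = {k<..p}" by auto
  then show ?thesis by (simp add: shuffle_sign_singleton_right)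
qed

section \<open>The algebra of wedge products\<close>

text \<open>Families of coefficients are indexed by all sets of naturals. A sum over an infinite power set
  is \<open>0\<close>, so a wedge product has no coefficients at infinite index sets; this is what makes
  associativity hold without a restriction on the index set.\<close>

lemma wedge_infinite: "infinite K \<Longrightarrow> (\<alpha> \<and>\<^sub>f \<beta>) K x = 0"
  by (simp add: wedge_def finite_Pow_iff)

lemma wedge_cong:
  assumes "\<And>I. \<alpha> I x = \<alpha>' I x" "\<And>I. \<beta> I x = \<beta>' I x"
  shows "(\<alpha> \<and>\<^sub>f \<beta>) K x = (\<alpha>' \<and>\<^sub>f \<beta>') K x"
  by (simp add: wedge_def assms)

text \<open>Both sides are sums over the ways to split the index set into three parts \<open>J\<close>, \<open>L\<close>, \<open>R\<close>; the two
  signs agree because inversions between \<open>J\<close>, \<open>L\<close> and \<open>R\<close> are counted pair by pair.\<close>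

lemma wedge_assoc: "(\<alpha> \<and>\<^sub>f \<beta>) \<and>\<^sub>f \<gamma> = \<alpha> \<and>\<^sub>f (\<beta> \<and>\<^sub>f \<gamma>)"
proof (intro ext)
  fix K :: "nat set" and x
  show "((\<alpha> \<and>\<^sub>f \<beta>) \<and>\<^sub>f \<gamma>) K x = (\<alpha> \<and>\<^sub>f (\<beta> \<and>\<^sub>f \<gamma>)) K x"
  proof (cases "finite K")
    case False
    then show ?thesis by (simp add: wedge_infinite)
  next
    case True
    have finI: "finite I" if "I \<subseteq> K" for I using that True finite_subset by blast
    have "((\<alpha> \<and>\<^sub>f \<beta>) \<and>\<^sub>f \<gamma>) K x = (\<Sum>I\<in>Pow K. \<Sum>J\<in>Pow I.
        shuffle_sign I (K - I) * (shuffle_sign J (I - J) * \<alpha> J x * \<beta> (I - J) x) * \<gamma> (K - I) x)"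
      by (simp add: wedge_def sum_distrib_left sum_distrib_right)
    also have "\<dots> = (\<Sum>(I, J)\<in>Sigma (Pow K) Pow.
        shuffle_sign I (K - I) * (shuffle_sign J (I - J) * \<alpha> J x * \<beta> (I - J) x) * \<gamma> (K - I) x)"
      using True finI by (subst sum.Sigma) auto
    also have "\<dots> = (\<Sum>(J, L)\<in>Sigma (Pow K) (\<lambda>J. Pow (K - J)).
        shuffle_sign J (K - J) * \<alpha> J x * (shuffle_sign L (K - J - L) * \<beta> L x * \<gamma> (K - J - L) x))"
    proof (rule sum.reindex_bij_witness[where i = "\<lambda>(J, L). (J \<union> L, J)" and j = "\<lambda>(I, J). (J, I - J)"],
        safe, goal_cases)
      case (7 I J)
      define L where "L = I - J"
      define R where "R = K - I"
      have eq: "I = J \<union> L" "K - J = L \<union> R" "K - J - (I - J) = R" "J \<inter> L = {}" "L \<inter> R = {}"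
        using 7 by (auto simp: L_def R_def)
      have fin: "finite J" "finite L" "finite R"
        using 7 True finI by (auto simp: L_def R_def intro: finite_subset)
      have "shuffle_sign I R * shuffle_sign J L = shuffle_sign J (K - J) * shuffle_sign L R"
        unfolding eq(2) using eq fin by (subst eq(1)) (simp add: shuffle_sign_Un_left shuffle_sign_Un_right)
      then show ?case
        unfolding L_def[symmetric] R_def[symmetric] eq(3)[folded L_def] by algebra
    qed auto
    also have "\<dots> = (\<Sum>J\<in>Pow K. \<Sum>L\<in>Pow (K - J).
        shuffle_sign J (K - J) * \<alpha> J x * (shuffle_sign L (K - J - L) * \<beta> L x * \<gamma> (K - J - L) x))"
      using True by (subst sum.Sigma) auto
    also have "\<dots> = (\<alpha> \<and>\<^sub>f (\<beta> \<and>\<^sub>f \<gamma>)) K x"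
      by (simp add: wedge_def sum_distrib_left)
    finally show ?thesis .
  qed
qed

lemma wedge_one_right: "finite K \<Longrightarrow> (\<alpha> \<and>\<^sub>f fun_form (\<lambda>x. 1)) K x = \<alpha> K x"
proof -
  assume "finite K"
  then have "(\<alpha> \<and>\<^sub>f fun_form (\<lambda>x. 1)) K x =
      (\<Sum>I\<in>{K}. shuffle_sign I (K - I) * \<alpha> I x * fun_form (\<lambda>x. 1) (K - I) x)"
    unfolding wedge_def by (intro sum.mono_neutral_right) (auto simp: fun_form_def)
  then show ?thesis by (simp add: fun_form_def)
qed

lemma wedge_one_left: "finite K \<Longrightarrow> (fun_form (\<lambda>x. 1) \<and>\<^sub>f \<alpha>) K x = \<alpha> K x"
proof -
  assume "finite K"
  then have "(fun_form (\<lambda>x. 1) \<and>\<^sub>f \<alpha>) K x =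
      (\<Sum>I\<in>{{}}. shuffle_sign I (K - I) * fun_form (\<lambda>x. 1) I x * \<alpha> (K - I) x)"
    unfolding wedge_def by (intro sum.mono_neutral_right) (auto simp: fun_form_def)
  then show ?thesis by (simp add: fun_form_def)
qed

text \<open>An iterated wedge is nested to the right, while a product of one-forms is computed by adding one
  factor at a time on the right. The constant \<open>1\<close> is a unit only at finite index sets, but it cuts a
  form off at infinite ones in the same way from either side, so the identity is unconditional.\<close>

lemma wedges_snoc: "wedges (\<alpha>s @ [\<beta>]) = wedges \<alpha>s \<and>\<^sub>f \<beta>"
proof (induction \<alpha>s)
  case Nil
  have "\<beta> \<and>\<^sub>f fun_form (\<lambda>x. 1) = fun_form (\<lambda>x. 1) \<and>\<^sub>f \<beta>"
  proof (intro ext)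
    fix K x
    show "(\<beta> \<and>\<^sub>f fun_form (\<lambda>x. 1)) K x = (fun_form (\<lambda>x. 1) \<and>\<^sub>f \<beta>) K x"
      by (cases "finite K") (simp_all add: wedge_one_left wedge_one_right wedge_infinite)
  qed
  then show ?case by (simp add: wedges_def)
next
  case (Cons \<alpha> \<alpha>s)
  then show ?case by (simp add: wedges_def wedge_assoc)
qed

lemma wedge_one_form_left:
  assumes "finite K" and "\<And>I. \<not> is_singleton I \<Longrightarrow> \<theta> I x = 0"
  shows "(\<theta> \<and>\<^sub>f \<beta>) K x = (\<Sum>k\<in>K. shuffle_sign {k} (K - {k}) * \<theta> {k} x * \<beta> (K - {k}) x)"
proof -
  have "(\<theta> \<and>\<^sub>f \<beta>) K x =
      (\<Sum>I\<in>(\<lambda>k. {k}) ` K. shuffle_sign I (K - I) * \<theta> I x * \<beta> (K - I) x)"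
    unfolding wedge_def
  proof (rule sum.mono_neutral_right)
    show "\<forall>I\<in>Pow K - (\<lambda>k. {k}) ` K. shuffle_sign I (K - I) * \<theta> I x * \<beta> (K - I) x = 0"
      using assms(2) by (auto simp: is_singleton_def)
  qed (use assms(1) in auto)
  then show ?thesis by (simp add: sum.reindex)
qed

lemma wedge_one_form_right:
  assumes "finite K" and "\<And>I. \<not> is_singleton I \<Longrightarrow> \<theta> I x = 0"
  shows "(\<alpha> \<and>\<^sub>f \<theta>) K x = (\<Sum>k\<in>K. shuffle_sign (K - {k}) {k} * \<alpha> (K - {k}) x * \<theta> {k} x)"
proof -
  have inj: "inj_on (\<lambda>k. K - {k}) K" by (auto simp: inj_on_def)
  have "(\<alpha> \<and>\<^sub>f \<theta>) K x =
      (\<Sum>I\<in>(\<lambda>k. K - {k}) ` K. shuffle_sign I (K - I) * \<alpha> I x * \<theta> (K - I) x)"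
    unfolding wedge_def
  proof (rule sum.mono_neutral_right)
    have "I \<in> (\<lambda>k. K - {k}) ` K" if "I \<subseteq> K" "is_singleton (K - I)" for I
      using that by (auto simp: is_singleton_def)
    then show "\<forall>I\<in>Pow K - (\<lambda>k. K - {k}) ` K. shuffle_sign I (K - I) * \<alpha> I x * \<theta> (K - I) x = 0"
      using assms(2) by auto
  qed (use assms(1) in auto)
  also have "\<dots> = (\<Sum>k\<in>K. shuffle_sign (K - {k}) {k} * \<alpha> (K - {k}) x * \<theta> {k} x)"
    by (simp add: sum.reindex[OF inj] double_diff Diff_Diff_Int cong: sum.cong)
  finally show ?thesis .
qed

text \<open>The indices are increasing, so each factor is wedged in front of larger ones and no sign arises.\<close>

lemma wedges_coordinate_forms:
  assumes "sorted_wrt (<) xs"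
    and "\<And>i I. i \<in> set xs \<Longrightarrow> \<alpha> i I x = (if I = {i} then c i else 0)"
  shows "wedges (map \<alpha> xs) K x = (if K = set xs then \<Prod>i\<in>set xs. c i else 0)"
  using assms
proof (induction xs arbitrary: K)
  case Nil
  then show ?case by (simp add: wedges_def fun_form_def)
next
  case (Cons i xs)
  have IH: "wedges (map \<alpha> xs) J x = (if J = set xs then \<Prod>i\<in>set xs. c i else 0)" for J
    using Cons by simp
  have less: "j \<in> set xs \<Longrightarrow> i < j" for j using Cons.prems(1) by simp
  have step: "wedges (map \<alpha> (i # xs)) K x = (\<alpha> i \<and>\<^sub>f wedges (map \<alpha> xs)) K x"
    by (simp add: wedges_def)
  show ?case
  proof (cases "finite K")
    case False
    then show ?thesis unfolding step by (auto simp: wedge_infinite)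
  next
    case True
    have "(\<alpha> i \<and>\<^sub>f wedges (map \<alpha> xs)) K x =
        (\<Sum>k\<in>K. shuffle_sign {k} (K - {k}) * \<alpha> i {k} x * wedges (map \<alpha> xs) (K - {k}) x)"
      using Cons.prems(2) by (intro wedge_one_form_left True) (auto simp: is_singleton_def)
    also have "\<dots> = (\<Sum>k\<in>K. if k = i then shuffle_sign {i} (K - {i}) * c i * wedges (map \<alpha> xs) (K - {i}) x else 0)"
      using Cons.prems(2) by (intro sum.cong) auto
    also have "\<dots> = (if i \<in> K then shuffle_sign {i} (K - {i}) * c i * wedges (map \<alpha> xs) (K - {i}) x else 0)"
      using True by simp
    also have "\<dots> = (if K = set (i # xs) then \<Prod>i\<in>set (i # xs). c i else 0)"
    proof (cases "i \<in> K \<and> K - {i} = set xs")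
      case True
      have "{b \<in> K - {i}. b < i} = {}" using less True by force
      then have "shuffle_sign {i} (K - {i}) = 1"
        unfolding shuffle_sign_singleton_left by (simp only: card.empty power_0)
      moreover have "K = set (i # xs)" using True by auto
      moreover have "i \<notin> set xs" using less by blast
      ultimately show ?thesis using True by (simp add: IH)
    next
      case False
      moreover have "i \<notin> set xs" using less by blast
      ultimately have "K \<noteq> set (i # xs)" by auto
      then show ?thesis using False by (auto simp: IH)
    qed
    finally show ?thesis unfolding step .
  qed
qed

section \<open>Contractions of the volume form\<close>

text \<open>The coefficients, at a fixed point, of the contraction of the vector \<open>v\<close> with
  \<open>dx\<^sub>0 \<and> \<dots> \<and> dx\<^sub>p\<close>. At most one \<open>j\<close> contributes to each index set; a sum is used so that the value
  is \<open>0\<close> when there is none.\<close>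

definition vol_contraction :: "nat \<Rightarrow> (nat \<Rightarrow> complex) \<Rightarrow> nat set \<Rightarrow> complex" where
  "vol_contraction p v I = (\<Sum>j | j \<le> p \<and> I = {..p} - {j}. (- 1) ^ j * v j)"

lemma vol_contraction_coeff:
  assumes "j \<le> p"
  shows "vol_contraction p v ({..p} - {j}) = (- 1) ^ j * v j"
proof -
  have "{i. i \<le> p \<and> {..p} - {j} = {..p} - {i}} = {j}" using assms by auto
  then show ?thesis by (simp add: vol_contraction_def)
qed

lemma vol_contraction_eq_0:
  assumes "\<And>j. j \<le> p \<Longrightarrow> I \<noteq> {..p} - {j}"
  shows "vol_contraction p v I = 0"
  unfolding vol_contraction_def using assms by (intro sum.neutral) blast

lemma vol_contraction_nonzeroE:
  assumes "vol_contraction p v I \<noteq> 0"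
  obtains j where "j \<le> p" "I = {..p} - {j}"
  using assms vol_contraction_eq_0 by blast

lemma eq_atMost_if_Diff_singleton_eq:
  fixes k p :: nat
  assumes "k \<in> K" "k \<le> p" "K - {k} = {..p} - {j}"
  shows "K = {..p}"
proof -
  have "k \<notin> {..p} - {j}" unfolding assms(3)[symmetric] by simp
  then have "k = j" using assms(2) by simp
  have "insert k (K - {k}) = K" using assms(1) by (rule insert_Diff)
  then have "K = insert k ({..p} - {j})" unfolding assms(3) by (rule sym)
  also have "\<dots> = {..p}" using \<open>k = j\<close> assms(2) by auto
  finally show ?thesis .
qed

text \<open>Contraction with \<open>v\<close> is an antiderivation. If \<open>\<theta>(v) = 0\<close>, contracting \<open>v\<close> with
  \<open>dx\<^sub>0 \<and> \<dots> \<and> dx\<^sub>p \<and> \<theta>\<close> therefore affects only the first factors, while in that product only the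
  component of \<open>\<theta>\<close> along \<open>dx\<^sub>p\<^sub>+\<^sub>1\<close> survives. In coefficients: at an index set containing \<open>p + 1\<close> a single
  term remains, and at \<open>{..p}\<close> the hypothesis \<open>\<theta>(v) = 0\<close> rewrites the sum of the others.\<close>

lemma vol_contraction_wedge_one_form:
  assumes \<alpha>: "\<And>I. \<alpha> I x = vol_contraction p v I"
    and \<theta>: "\<And>I. \<not> is_singleton I \<Longrightarrow> \<theta> I x = 0" "\<And>k. Suc p < k \<Longrightarrow> \<theta> {k} x = 0"
    and kernel: "(\<Sum>j\<le>Suc p. v j * \<theta> {j} x) = 0"
  shows "(\<alpha> \<and>\<^sub>f \<theta>) K x = vol_contraction (Suc p) (\<lambda>j. v j * \<theta> {Suc p} x) K"
proof (cases "finite K")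
  case False
  then have "K \<noteq> {..Suc p} - {j}" for j by auto
  then show ?thesis using False by (simp add: wedge_infinite vol_contraction_eq_0)
next
  case True
  let ?t = "\<lambda>k. shuffle_sign (K - {k}) {k} * vol_contraction p v (K - {k}) * \<theta> {k} x"
  have sum: "(\<alpha> \<and>\<^sub>f \<theta>) K x = (\<Sum>k\<in>K. ?t k)"
    using wedge_one_form_right[where \<theta> = \<theta> and x = x, OF True] \<theta>(1) \<alpha> by simp
  consider "K = {..p}" | j where "j \<le> p" "K = {..Suc p} - {j}"
    | "\<And>j. j \<le> Suc p \<Longrightarrow> K \<noteq> {..Suc p} - {j}"
  proof -
    have "{..p} = {..Suc p} - {Suc p}" by auto
    then show ?thesis using that unfolding le_Suc_eq by blast
  qed
  then show ?thesis
  proof cases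
    case 1
    have K: "K = {..Suc p} - {Suc p}" using 1 by auto
    have "?t k = (- 1) ^ p * (v k * \<theta> {k} x)" if "k \<in> K" for k
    proof -
      have "(- 1 :: complex) ^ (p - k) * (- 1) ^ k = (- 1) ^ p"
        using that 1 by (simp flip: power_add)
      then show ?thesis
        using that 1 by (simp add: shuffle_sign_atMost_singleton vol_contraction_coeff flip: mult.assoc)
    qed
    then have "(\<Sum>k\<in>K. ?t k) = (\<Sum>k\<in>K. (- 1) ^ p * (v k * \<theta> {k} x))"
      by (rule sum.cong[OF refl])
    also have "\<dots> = (- 1) ^ p * (\<Sum>k\<le>p. v k * \<theta> {k} x)"
      by (simp only: 1 sum_distrib_left)
    also have "(\<Sum>k\<le>p. v k * \<theta> {k} x) = - (v (Suc p) * \<theta> {Suc p} x)"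
      using kernel by (simp add: add_eq_0_iff2)
    finally show ?thesis unfolding sum by (simp add: K vol_contraction_coeff)
  next
    case (2 j)
    have "?t k = 0" if "k \<in> K - {Suc p}" for k
    proof -
      have "Suc p \<in> K - {k}" using that 2 by auto
      then have "K - {k} \<noteq> {..p} - {i}" for i by (metis DiffD1 atMost_iff not_less_eq_eq order_refl)
      then have "vol_contraction p v (K - {k}) = 0" by (rule vol_contraction_eq_0)
      then show ?thesis by simp
    qed
    then have "(\<Sum>k\<in>K - {Suc p}. ?t k) = 0"
      by (rule sum.neutral[OF ballI])
    moreover have "Suc p \<in> K" using 2 by auto
    ultimately have "(\<Sum>k\<in>K. ?t k) = ?t (Suc p)"
      using sum.remove[OF True, of "Suc p" ?t] by (simp only: add_0_right)
    moreover have "K - {Suc p} = {..p} - {j}" using 2 by auto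
    moreover have "shuffle_sign ({..p} - {j}) {Suc p} = 1"
    proof -
      have "{a \<in> {..p} - {j}. Suc p < a} = {}" by auto
      then show ?thesis unfolding shuffle_sign_singleton_right by (simp only: card.empty power_0)
    qed
    ultimately have "(\<alpha> \<and>\<^sub>f \<theta>) K x = (- 1) ^ j * v j * \<theta> {Suc p} x"
      using 2(1) by (simp only: sum vol_contraction_coeff mult_1_left)
    then show ?thesis
      using 2 by (simp only: vol_contraction_coeff le_SucI mult.assoc)
  next
    case 3
    have "?t k = 0" if "k \<in> K" for k
    proof (rule ccontr)
      assume "?t k \<noteq> 0"
      then have nz: "vol_contraction p v (K - {k}) \<noteq> 0" "\<theta> {k} x \<noteq> 0" by simp_all
      have "k \<le> Suc p" using \<theta>(2)[of k] nz(2) not_less by blast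
      obtain j where j: "j \<le> p" "K - {k} = {..p} - {j}"
        using nz(1) vol_contraction_nonzeroE by blast
      have "K = {..Suc p} - {j} \<or> K = {..Suc p} - {Suc p}"
      proof (cases "k = Suc p")
        case True
        have "insert k (K - {k}) = K" using that by (rule insert_Diff)
        then have "K = insert k ({..p} - {j})" unfolding j(2) by (rule sym)
        also have "\<dots> = {..Suc p} - {j}" unfolding True using j(1) by auto
        finally show ?thesis ..
      next
        case False
        then have "K = {..p}"
          using \<open>k \<le> Suc p\<close> eq_atMost_if_Diff_singleton_eq[OF that _ j(2)] by simp
        then show ?thesis by auto
      qed
      then show False using 3[of j] 3[of "Suc p"] j(1) le_SucI by blast
    qed
    then have "(\<Sum>k\<in>K. ?t k) = 0" by (rule sum.neutral[OF ballI])
    then show ?thesis unfolding sum using 3 by (simp add: vol_contraction_eq_0)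
  qed
qed

text \<open>Contracting \<open>\<omega>\<close> with all but two basis vectors \<open>e\<^sub>a\<close>, \<open>e\<^sub>b\<close> leaves, up to sign,
  \<open>v\<^sub>a dx\<^sub>b - v\<^sub>b dx\<^sub>a\<close>. This one-form annihilates \<open>v\<close>, so its wedge with \<open>\<omega>\<close> vanishes: the only index
  set in question is \<open>{..p}\<close>, where the terms of \<open>a\<close> and \<open>b\<close> cancel.\<close>

lemma contract_vol_contraction_wedge:
  assumes \<omega>: "\<And>I. \<omega> I x = vol_contraction p v I"
    and J: "J \<subseteq> {..p}" "Suc (card J) = p"
  shows "(contract J \<omega> \<and>\<^sub>f \<omega>) K x = 0"
proof (cases "finite K")
  case False
  then show ?thesis by (simp add: wedge_infinite)
next
  case True
  have finJ: "finite J" using J(1) finite_subset by blast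
  have contr: "contract J \<omega> I x = (if J \<inter> I = {} then shuffle_sign J I * vol_contraction p v (J \<union> I) else 0)" for I
    by (simp add: contract_def \<omega>)
  have one_form: "contract J \<omega> I x = 0" if "\<not> is_singleton I" for I
  proof (rule ccontr)
    assume "contract J \<omega> I x \<noteq> 0"
    then have disj: "J \<inter> I = {}" and "vol_contraction p v (J \<union> I) \<noteq> 0"
      by (auto simp: contr split: if_splits)
    then obtain j where j: "j \<le> p" "J \<union> I = {..p} - {j}" using vol_contraction_nonzeroE by blast
    have "finite I" using j(2) by (metis finite_Diff finite_Un finite_atMost)
    then have "card J + card I = p"
      using card_Un_disjoint[OF finJ _ disj] j by simp
    then have "card I = 1" using J(2) by simp
    then show False using that by (simp add: is_singleton_altdef)
  qed
  let ?t = "\<lambda>k. shuffle_sign {k} (K - {k}) * contract J \<omega> {k} x * \<omega> (K - {k}) x"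
  have sum: "(contract J \<omega> \<and>\<^sub>f \<omega>) K x = (\<Sum>k\<in>K. ?t k)"
    by (rule wedge_one_form_left[OF True]) (rule one_form)
  show ?thesis
  proof (cases "K = {..p}")
    case False
    have "?t k = 0" if "k \<in> K" for k
    proof (rule ccontr)
      assume "?t k \<noteq> 0"
      then have nz: "vol_contraction p v (J \<union> {k}) \<noteq> 0" "vol_contraction p v (K - {k}) \<noteq> 0"
        by (auto simp: contr \<omega> split: if_splits)
      obtain i where "J \<union> {k} = {..p} - {i}" using vol_contraction_nonzeroE[OF nz(1)] by blast
      then have "k \<le> p" by blast
      obtain j where "K - {k} = {..p} - {j}"
        using vol_contraction_nonzeroE[OF nz(2)] by blast
      then have "K = {..p}" by (rule eq_atMost_if_Diff_singleton_eq[OF that \<open>k \<le> p\<close>])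
      then show False using False by simp
    qed
    then show ?thesis unfolding sum by (rule sum.neutral[OF ballI])
  next
    case K: True
    have "card ({..p} - J) = 2" using J finJ by (simp add: card_Diff_subset)
    then obtain i j where ij: "{..p} - J = {i, j}" "i \<noteq> j" by (auto simp: card_2_iff)
    define a b where "a = min i j" and "b = max i j"
    have ab: "{..p} - J = {a, b}" "a < b"
      using ij by (auto simp: a_def b_def min_def max_def)
    have le: "a \<le> p" "b \<le> p" using ab(1) by blast+
    have J_eq: "J = {..p} - {a, b}" using double_diff[OF J(1) order_refl] unfolding ab(1) by (rule sym)
    have "?t k = 0" if "k \<in> K - {a, b}" for k
    proof -
      have "k \<in> J" using that unfolding K J_eq by blast
      then have "J \<inter> {k} \<noteq> {}" by blast
      then show ?thesis by (simp only: contr if_False mult_zero_left mult_zero_right)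
    qed
    moreover have "{a, b} \<subseteq> K" using K le by blast
    ultimately have "(\<Sum>k\<in>K. ?t k) = (\<Sum>k\<in>{a, b}. ?t k)"
      by (intro sum.mono_neutral_right[OF True] ballI)
    also have "\<dots> = ?t a + ?t b"
      using ab(2) by (subst sum.insert) (simp_all del: mult_eq_0_iff)
    finally have two: "(\<Sum>k\<in>K. ?t k) = ?t a + ?t b" .
    have eqs: "J \<union> {a} = {..p} - {b}" "J \<union> {b} = {..p} - {a}" "J \<inter> {a} = {}" "J \<inter> {b} = {}"
      unfolding J_eq using ab(2) le by auto
    have "{j \<in> J. a < j} = {a<..p} - {b}" unfolding J_eq by auto
    then have "card {j \<in> J. a < j} = p - a - 1" using ab le by simp
    then have sa: "shuffle_sign J {a} = (- 1) ^ (p - a - 1)"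
      by (simp add: shuffle_sign_singleton_right)
    have "{j \<in> J. b < j} = {b<..p}" unfolding J_eq using ab(2) by auto
    then have sb: "shuffle_sign J {b} = (- 1) ^ (p - b)"
      by (simp add: shuffle_sign_singleton_right)
    have ta: "?t a = (- 1) ^ a * (- 1) ^ (p - a - 1) * ((- 1) ^ a * v a * ((- 1) ^ b * v b))"
      using le by (simp only: K contr \<omega> eqs sa shuffle_sign_singleton_atMost vol_contraction_coeff
          simp_thms if_True mult_ac)
    have tb: "?t b = (- 1) ^ b * (- 1) ^ (p - b) * ((- 1) ^ a * v a * ((- 1) ^ b * v b))"
      using le by (simp only: K contr \<omega> eqs sb shuffle_sign_singleton_atMost vol_contraction_coeff
          simp_thms if_True mult_ac)
    \<comment> \<open>Since \<open>b\<close> is missing from \<open>J\<close>, the sign of \<open>a\<close> has one inversion fewer than that of \<open>b\<close>.\<close>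
    have "(- 1 :: complex) ^ a * (- 1) ^ (p - a - 1) = (- 1) ^ (p - 1)"
      using ab le by (simp flip: power_add)
    moreover have "(- 1 :: complex) ^ b * (- 1) ^ (p - b) = - ((- 1) ^ (p - 1))"
      using ab le by (cases p) (simp_all flip: power_add)
    ultimately show ?thesis unfolding sum two ta tb by simp
  qed
qed

section \<open>Monomials\<close>

lemma h_monom_nonzero: "(\<And>j. j \<le> l \<Longrightarrow> x j \<noteq> 0) \<Longrightarrow> h_monom l a x \<noteq> 0"
  by (simp add: h_monom_def)

lemma h_monom_upd:
  assumes "k \<le> l"
  shows "h_monom l a (x(k := t)) = t ^ a k * (\<Prod>j\<in>{..l} - {k}. x j ^ a j)"
  using assms by (simp add: h_monom_def prod.remove[of "{..l}" k])

lemma h_monom_upd_other: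
  assumes "l < k"
  shows "h_monom l a (x(k := t)) = h_monom l a x"
  using assms by (auto simp: h_monom_def intro!: prod.cong)

lemma h_monom_has_field_derivative:
  assumes "k \<le> l" "x k \<noteq> 0"
  shows "((\<lambda>t. h_monom l a (x(k := t))) has_field_derivative of_nat (a k) * h_monom l a x / x k) (at (x k))"
proof -
  have "h_monom l a x = x k ^ a k * (\<Prod>j\<in>{..l} - {k}. x j ^ a j)"
    using h_monom_upd[OF assms(1), of a x "x k"] by simp
  moreover have "((\<lambda>t. t ^ a k * (\<Prod>j\<in>{..l} - {k}. x j ^ a j)) has_field_derivative
      of_nat (a k) * x k ^ (a k - 1) * (\<Prod>j\<in>{..l} - {k}. x j ^ a j)) (at (x k))"
    by (auto intro!: derivative_eq_intros)
  ultimately show ?thesis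
    unfolding h_monom_upd[OF assms(1)] using assms(2) by (cases "a k") (simp_all add: mult.assoc)
qed

lemma deriv_quotient_h_monom:
  assumes "k \<le> l" "\<And>j. j \<le> l \<Longrightarrow> x j \<noteq> 0"
    and "(g has_field_derivative g') (at (x k))"
  shows "deriv (\<lambda>t. g t / h_monom l a (x(k := t))) (x k) =
    (g' - of_nat (a k) * g (x k) / x k) / h_monom l a x"
proof (rule DERIV_imp_deriv)
  have nz: "h_monom l a x \<noteq> 0" "x k \<noteq> 0" using assms(1,2) h_monom_nonzero[of l x a] by auto
  have "((\<lambda>t. g t / h_monom l a (x(k := t))) has_field_derivative
      (g' * h_monom l a x - g (x k) * (of_nat (a k) * h_monom l a x / x k)) /
      (h_monom l a x * h_monom l a x)) (at (x k))"
    using DERIV_divide[OF assms(3) h_monom_has_field_derivative[OF assms(1), of x a]] nz by simp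
  moreover have "(g' * h_monom l a x - g (x k) * (of_nat (a k) * h_monom l a x / x k)) /
      (h_monom l a x * h_monom l a x) = (g' - of_nat (a k) * g (x k) / x k) / h_monom l a x"
    using nz by (simp add: field_simps)
  ultimately show "((\<lambda>t. g t / h_monom l a (x(k := t))) has_field_derivative
      (g' - of_nat (a k) * g (x k) / x k) / h_monom l a x) (at (x k))"
    by simp
qed

lemma partial_phi:
  assumes "l < i" "\<And>j. j \<le> l \<Longrightarrow> x j \<noteq> 0"
  shows "partial k (phi l i m) x = (if k \<le> l then - (of_nat (m k) * x i / (x k * h_monom l m x))
     else if k = i then 1 / h_monom l m x else 0)"
proof (cases "k \<le> l")
  case True
  then have "partial k (phi l i m) x = deriv (\<lambda>t. x i / h_monom l m (x(k := t))) (x k)"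
    using assms(1) by (simp add: partial_def phi_def)
  also have "\<dots> = (0 - of_nat (m k) * x i / x k) / h_monom l m x"
    using True assms(2) by (intro deriv_quotient_h_monom) auto
  finally show ?thesis using True by simp
next
  case False
  show ?thesis
  proof (cases "k = i")
    case True
    have "((\<lambda>t. t / h_monom l m x) has_field_derivative 1 / h_monom l m x) (at (x i))"
      by (rule DERIV_cdivide[OF DERIV_ident])
    then show ?thesis
      using True assms(1) by (simp add: partial_def phi_def h_monom_upd_other DERIV_imp_deriv)
  next
    case False
    with \<open>\<not> k \<le> l\<close> show ?thesis
      using assms(1) by (simp add: partial_def phi_def h_monom_upd_other)
  qed
qed

text \<open>The derivative of \<open>\<phi>\<close> along the vector field vanishes: numerator and denominator of \<open>\<phi>\<close> are
  eigenfunctions of it, with the same eigenvalue by the resonance relation.\<close>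

lemma euler_phi:
  assumes "l < i" "\<And>j. j \<le> l \<Longrightarrow> x j \<noteq> 0" "(\<Sum>j\<le>l. m j * lam j) = lam i"
  shows "(\<Sum>k\<le>i. of_nat (lam k) * x k * partial k (phi l i m) x) = 0"
proof -
  let ?t = "\<lambda>k. of_nat (lam k) * x k * partial k (phi l i m) x"
  have "(\<Sum>k\<le>i. ?t k) = (\<Sum>k\<in>insert i {..l}. ?t k)"
    using assms(1,2) by (intro sum.mono_neutral_right) (auto simp: partial_phi)
  also have "\<dots> = ?t i + (\<Sum>k\<le>l. ?t k)"
    using assms(1) by simp
  also have "(\<Sum>k\<le>l. ?t k) = (\<Sum>k\<le>l. - (x i / h_monom l m x) * of_nat (m k * lam k))"
    using assms(1,2) by (intro sum.cong) (auto simp: partial_phi field_simps)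
  also have "\<dots> = - (x i / h_monom l m x) * of_nat (lam i)"
    by (simp only: assms(3)[symmetric] of_nat_sum sum_distrib_left)
  also have "?t i = (x i / h_monom l m x) * of_nat (lam i)"
    using assms(1,2) by (simp add: partial_phi)
  finally show ?thesis by simp
qed

section \<open>The forms of the theorem\<close>

lemma sum_form_apply: "(\<Sum>j\<in>A. F j) I x = (\<Sum>j\<in>A. (F j :: dform) I x)"
  by (induction A rule: infinite_finite_induct) auto

lemma set_omit: "set (omit d j) = {..d} - {j}"
  by (auto simp: omit_def)

lemma sorted_omit: "sorted_wrt (<) (omit d j)"
  unfolding omit_def by (intro sorted_wrt_filter sorted_wrt_upt)

lemma Omega_form_eq: "Omega_form d lam I x = vol_contraction d (\<lambda>j. of_nat (lam j) * x j) I"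
proof -
  have "wedges (map dx (omit d j)) I x = (if I = {..d} - {j} then 1 else 0)" for j
    using wedges_coordinate_forms[OF sorted_omit, of d j dx x "\<lambda>_. 1"]
    by (simp add: set_omit dx_def)
  then have "Omega_form d lam I x = (\<Sum>j\<le>d. if I = {..d} - {j} then (- 1) ^ j * (of_nat (lam j) * x j) else 0)"
    by (auto simp: Omega_form_def sum_form_apply fscale_def intro!: sum.cong)
  also have "\<dots> = vol_contraction d (\<lambda>j. of_nat (lam j) * x j) I"
    unfolding vol_contraction_def by (simp add: sum.inter_filter[symmetric])
  finally show ?thesis .
qed

lemma eta_NR_eq:
  assumes "\<And>j. j \<le> l \<Longrightarrow> x j \<noteq> 0"
  shows "eta_NR l lam I x = vol_contraction l (\<lambda>j. of_nat (lam j) * x j / (\<Prod>i\<le>l. x i)) I"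
proof -
  have w: "wedges (map (\<lambda>i. dx i /\<^sub>f (\<lambda>x. x i)) (omit l j)) I x =
      (if I = {..l} - {j} then x j / (\<Prod>i\<le>l. x i) else 0)" if "j \<le> l" for j
  proof -
    have "wedges (map (\<lambda>i. dx i /\<^sub>f (\<lambda>x. x i)) (omit l j)) I x =
        (if I = set (omit l j) then \<Prod>i\<in>set (omit l j). 1 / x i else 0)"
      by (rule wedges_coordinate_forms[OF sorted_omit]) (simp add: dx_def fdivide_def)
    moreover have "(\<Prod>i\<in>{..l} - {j}. 1 / x i) = x j / (\<Prod>i\<le>l. x i)"
      using that assms by (simp add: prod.remove[of "{..l}" j] prod_dividef)
    ultimately show ?thesis by (simp add: set_omit)
  qed
  have "eta_NR l lam I x =
      (\<Sum>j\<le>l. if I = {..l} - {j} then (- 1) ^ j * (of_nat (lam j) * x j / (\<Prod>i\<le>l. x i)) else 0)"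
    by (auto simp: eta_NR_def sum_form_apply fscale_def w intro!: sum.cong)
  also have "\<dots> = vol_contraction l (\<lambda>j. of_nat (lam j) * x j / (\<Prod>i\<le>l. x i)) I"
    unfolding vol_contraction_def by (simp add: sum.inter_filter[symmetric])
  finally show ?thesis .
qed

lemma ext_d_fun_form_singleton: "k < N \<Longrightarrow> ext_d N (fun_form f) {k} x = partial k f x"
  by (simp add: ext_d_def partial_def fun_form_def)

lemma ext_d_fun_form_eq_0:
  assumes "\<not> (\<exists>k<N. K = {k})"
  shows "ext_d N (fun_form f) K x = 0"
proof (cases "K \<subseteq> {..<N}")
  case True
  have "partial k (fun_form f (K - {k})) x = 0" if "k \<in> K" for k
  proof -
    have "K - {k} \<noteq> {}" using assms that True by blast
    then show ?thesis by (simp add: partial_def fun_form_def)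
  qed
  then show ?thesis by (simp add: ext_d_def)
qed (simp add: ext_d_def)

text \<open>Induction on the last factor. Each \<open>d\<phi>\<close> annihilates the vector field, so wedging by it raises the
  dimension of the volume form by one and divides by one more resonant monomial.\<close>

lemma eta_wedge_d_phi:
  assumes x: "\<And>j. j \<le> l \<Longrightarrow> x j \<noteq> 0"
    and res: "\<And>i. i \<in> {l<..d} \<Longrightarrow> (\<Sum>j\<le>l. M i j * lam j) = lam i"
    and "l \<le> p" "p \<le> d"
  shows "(eta_NR l lam \<and>\<^sub>f wedges (map (\<lambda>i. ext_d (Suc d) (fun_form (phi l i (M i)))) [l + 1..<p + 1])) K x
    = vol_contraction p (\<lambda>j. of_nat (lam j) * x j / ((\<Prod>j\<le>l. x j) * H_prod p l M x)) K"
  using assms(3,4)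
proof (induction p arbitrary: K rule: dec_induct)
  case base
  show ?case
  proof (cases "finite K")
    case True
    then show ?thesis
      using x by (simp add: wedges_def wedge_one_right eta_NR_eq H_prod_def)
  next
    case False
    then have "K \<noteq> {..l} - {j}" for j by auto
    then show ?thesis using False by (simp add: wedge_infinite vol_contraction_eq_0)
  qed
next
  case (step p)
  let ?d\<phi> = "\<lambda>i. ext_d (Suc d) (fun_form (phi l i (M i)))"
  let ?\<alpha> = "eta_NR l lam \<and>\<^sub>f wedges (map ?d\<phi> [l + 1..<p + 1])"
  let ?v = "\<lambda>j. of_nat (lam j) * x j / ((\<Prod>j\<le>l. x j) * H_prod p l M x)"
  let ?i = "Suc p"
  have i: "l < ?i" "?i \<in> {l<..d}" using step by auto
  have upt: "[l + 1..<?i + 1] = [l + 1..<p + 1] @ [?i]" using step by simp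
  have coeff: "?d\<phi> ?i {k} x = partial k (phi l ?i (M ?i)) x" if "k \<le> ?i" for k
    using that step by (intro ext_d_fun_form_singleton) auto
  have "(\<Sum>j\<le>?i. ?v j * ?d\<phi> ?i {j} x) =
      (\<Sum>j\<le>?i. of_nat (lam j) * x j * partial j (phi l ?i (M ?i)) x) / ((\<Prod>j\<le>l. x j) * H_prod p l M x)"
    unfolding sum_divide_distrib by (intro sum.cong refl) (simp add: coeff)
  also have "\<dots> = 0"
    using euler_phi[of l ?i x "M ?i" lam, OF i(1) x res[OF i(2)]] by simp
  finally have kernel: "(\<Sum>j\<le>?i. ?v j * ?d\<phi> ?i {j} x) = 0" .
  have "(eta_NR l lam \<and>\<^sub>f wedges (map ?d\<phi> [l + 1..<?i + 1])) K x = (?\<alpha> \<and>\<^sub>f ?d\<phi> ?i) K x"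
    unfolding upt by (simp only: map_append list.map wedges_snoc wedge_assoc)
  also have "\<dots> = vol_contraction ?i (\<lambda>j. ?v j * ?d\<phi> ?i {?i} x) K"
  proof (rule vol_contraction_wedge_one_form)
    show "?\<alpha> I x = vol_contraction p ?v I" for I using step by simp
    show "?d\<phi> ?i I x = 0" if "\<not> is_singleton I" for I
      using that by (intro ext_d_fun_form_eq_0) (auto simp: is_singleton_def)
    show "?d\<phi> ?i {k} x = 0" if "?i < k" for k
    proof (cases "k < Suc d")
      case True
      then show ?thesis using that i x by (simp add: ext_d_fun_form_singleton partial_phi)
    next
      case False
      then show ?thesis by (intro ext_d_fun_form_eq_0) auto
    qed
    show "(\<Sum>j\<le>?i. ?v j * ?d\<phi> ?i {j} x) = 0" by (fact kernel)
  qed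
  also have "(\<lambda>j. ?v j * ?d\<phi> ?i {?i} x) =
      (\<lambda>j. of_nat (lam j) * x j / ((\<Prod>j\<le>l. x j) * H_prod ?i l M x))"
  proof -
    have "{l<..?i} = insert ?i {l<..p}" using i by auto
    then have "H_prod ?i l M x = H_prod p l M x * h_monom l (M ?i) x"
      by (simp add: H_prod_def mult.commute)
    moreover have "?d\<phi> ?i {?i} x = 1 / h_monom l (M ?i) x"
      using i x by (simp add: coeff partial_phi)
    ultimately show ?thesis by (simp add: mult.assoc)
  qed
  finally show ?case .
qed

section \<open>Closedness and integrability\<close>

lemma integrating_monomial:
  "(\<Prod>j\<le>l. x j) * H_prod d l M x = h_monom l (\<lambda>j. Suc (\<Sum>i\<in>{l<..d}. M i j)) x"
proof -
  have "H_prod d l M x = (\<Prod>j\<le>l. \<Prod>i\<in>{l<..d}. x j ^ M i j)"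
    unfolding H_prod_def h_monom_def by (rule prod.swap)
  then show ?thesis
    by (simp add: h_monom_def power_sum prod.distrib)
qed

text \<open>The exterior derivative of the contraction of a vector field with the volume form is its
  divergence times the volume form. For \<open>v/h\<close>, with \<open>v\<close> diagonal and \<open>h\<close> a monomial, the divergence is
  the trace of \<open>v\<close> minus the weight of \<open>h\<close>, divided by \<open>h\<close>.\<close>

lemma ext_d_vol_contraction:
  assumes \<omega>: "\<And>I y. \<omega> I y = vol_contraction d (\<lambda>j. of_nat (lam j) * y j / h_monom l a y) I"
    and x: "\<And>j. j \<le> l \<Longrightarrow> x j \<noteq> 0" and "l \<le> d"
    and weight: "(\<Sum>j\<le>l. a j * lam j) = (\<Sum>j\<le>d. lam j)"
  shows "ext_d (Suc d) \<omega> K x = 0"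
proof (cases "K = {..d}")
  case False
  have "partial k (\<omega> (K - {k})) x = 0" if "k \<in> K" "K \<subseteq> {..<Suc d}" for k
  proof -
    have "K - {k} \<noteq> {..d} - {j}" if "j \<le> d" for j
    proof
      assume "K - {k} = {..d} - {j}"
      moreover have "k \<le> d" using \<open>k \<in> K\<close> \<open>K \<subseteq> {..<Suc d}\<close> by auto
      ultimately have "K = {..d}" using eq_atMost_if_Diff_singleton_eq \<open>k \<in> K\<close> by blast
      then show False using False by simp
    qed
    then have "\<omega> (K - {k}) y = 0" for y by (simp add: \<omega> vol_contraction_eq_0)
    then show ?thesis by (simp add: partial_def)
  qed
  then show ?thesis by (simp add: ext_d_def)
next
  case True
  let ?h = "h_monom l a x"
  have summand: "shuffle_sign {k} (K - {k}) * partial k (\<omega> (K - {k})) x =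
      of_nat (lam k) * (1 - (if k \<le> l then of_nat (a k) else 0)) / ?h" if "k \<le> d" for k
  proof -
    have "partial k (\<omega> (K - {k})) x =
        deriv (\<lambda>t. (- 1) ^ k * of_nat (lam k) * t / h_monom l a (x(k := t))) (x k)"
      using True that by (simp add: partial_def \<omega> vol_contraction_coeff mult.assoc)
    also have "\<dots> = (- 1) ^ k * of_nat (lam k) * (1 - (if k \<le> l then of_nat (a k) else 0)) / ?h"
    proof (cases "k \<le> l")
      case True
      have "deriv (\<lambda>t. (- 1) ^ k * of_nat (lam k) * t / h_monom l a (x(k := t))) (x k) =
          ((- 1) ^ k * of_nat (lam k) - of_nat (a k) * ((- 1) ^ k * of_nat (lam k) * x k) / x k) / ?h"
        using True x by (intro deriv_quotient_h_monom) (auto intro!: derivative_eq_intros)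
      then show ?thesis using True x by (simp add: field_simps)
    next
      case False
      have "((\<lambda>t. (- 1) ^ k * of_nat (lam k) * t / ?h) has_field_derivative
          (- 1) ^ k * of_nat (lam k) / ?h) (at (x k))"
        using h_monom_nonzero[of l x a] x by (auto intro!: derivative_eq_intros)
      then show ?thesis using False by (simp add: h_monom_upd_other DERIV_imp_deriv)
    qed
    finally show ?thesis
      using True that by (simp add: shuffle_sign_singleton_atMost flip: mult.assoc power_mult_distrib)
  qed
  have "ext_d (Suc d) \<omega> K x = (\<Sum>k\<le>d. shuffle_sign {k} (K - {k}) * partial k (\<omega> (K - {k})) x)"
    using True by (simp add: ext_d_def lessThan_Suc_atMost)
  also have "\<dots> = (\<Sum>k\<le>d. of_nat (lam k) * (1 - (if k \<le> l then of_nat (a k) else 0)) / ?h)"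
    using summand by (intro sum.cong) auto
  also have "\<dots> = (\<Sum>k\<le>d. of_nat (lam k) - (if k \<le> l then of_nat (a k * lam k) else 0)) / ?h"
    unfolding sum_divide_distrib by (intro sum.cong) (auto simp: algebra_simps)
  also have "(\<Sum>k\<le>d. of_nat (lam k) - (if k \<le> l then of_nat (a k * lam k) else 0 :: complex)) =
      of_nat (\<Sum>k\<le>d. lam k) - (\<Sum>k\<le>l. of_nat (a k * lam k))"
  proof -
    have "(\<Sum>k\<le>d. if k \<le> l then of_nat (a k * lam k) else 0 :: complex) = (\<Sum>k\<le>l. of_nat (a k * lam k))"
      using \<open>l \<le> d\<close> by (intro sum.mono_neutral_cong_right) auto
    then show ?thesis by (simp add: sum_subtractf)
  qed
  also have "\<dots> = of_nat (\<Sum>k\<le>d. lam k) - of_nat (\<Sum>k\<le>l. a k * lam k)" by simp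
  also have "\<dots> = 0" unfolding weight by simp
  finally show ?thesis by simp
qed

section \<open>Holomorphy and regular points\<close>

lemma continuous_map_slice:
  assumes "q \<in> topspace (complex_space N)" "i < N"
  shows "continuous_map euclidean (complex_space N) (\<lambda>t. q(i := t))"
  using assms by (auto simp: continuous_map_componentwise PiE_def extensional_def)

text \<open>Moving only the coordinates in \<open>A\<close> gives density of the complement of the coordinate
  hyperplanes, and also that of generic points inside an intersection of some of them.\<close>

lemma open_contains_nonzero_coordinates:
  assumes "openin (complex_space N) V" "p \<in> V" "finite A" "A \<subseteq> {..<N}"
  shows "\<exists>q\<in>V. (\<forall>j\<in>A. q j \<noteq> 0) \<and> (\<forall>j. j \<notin> A \<longrightarrow> q j = p j)"
  using assms(3,4)
proof (induction A rule: finite_induct)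
  case empty
  then show ?case using assms(2) by blast
next
  case (insert i A)
  then obtain q where q: "q \<in> V" "\<forall>j\<in>A. q j \<noteq> 0" "\<forall>j. j \<notin> A \<longrightarrow> q j = p j" by blast
  have "q \<in> topspace (complex_space N)" using q(1) openin_subset[OF assms(1)] by blast
  moreover have "i < N" using insert.prems by simp
  ultimately have "openin euclidean {t \<in> topspace euclidean. q(i := t) \<in> V}"
    by (intro openin_continuous_map_preimage[OF continuous_map_slice assms(1)])
  then have "open {t. q(i := t) \<in> V}" by (simp only: open_openin topspace_euclidean UNIV_I simp_thms)
  moreover have "{t. q(i := t) \<in> V} \<noteq> {}"
  proof -
    have "q(i := q i) \<in> V" using q(1) by (simp only: fun_upd_triv)
    then show ?thesis by blast
  qed
  ultimately have "\<not> {t. q(i := t) \<in> V} \<subseteq> {0}"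
    using not_open_singleton[of "0 :: complex"] by (metis subset_singletonD)
  then obtain t where "q(i := t) \<in> V" "t \<noteq> 0" by blast
  moreover have "\<forall>j\<in>insert i A. (q(i := t)) j \<noteq> 0" using q(2) \<open>t \<noteq> 0\<close> by simp
  moreover have "\<forall>j. j \<notin> insert i A \<longrightarrow> (q(i := t)) j = p j" using q(3) by simp
  ultimately show ?case by blast
qed

lemma tendsto_coordinate_atin:
  assumes "j < N" "x \<in> topspace (complex_space N)"
  shows "((\<lambda>y. y j) \<longlongrightarrow> x j) (atin (complex_space N) x)"
proof -
  have "continuous_map (complex_space N) euclidean (\<lambda>y. y j)"
    using assms(1) continuous_map_product_projection[of j "{..<N}" "\<lambda>_. euclidean"] by simp
  then show ?thesis
    using assms(2) unfolding continuous_map_atin limitin_canonical_iff by blast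
qed

lemma holomorphic_in_coordinate:
  assumes "j < N"
  shows "holomorphic_in N (topspace (complex_space N)) (\<lambda>x. c * x j)"
proof -
  have "(\<lambda>t. c * (x(k := t)) j) field_differentiable at (x k)" for x k
    by (cases "k = j") (auto intro!: derivative_intros)
  moreover have "continuous_map (complex_space N) euclidean (\<lambda>x. c * x j)"
    unfolding continuous_map_atin limitin_canonical_iff
    using assms by (intro ballI tendsto_intros tendsto_coordinate_atin)
  ultimately show ?thesis by (simp add: holomorphic_in_def del: topspace_product_topology)
qed

lemma holomorphic_in_h_monom:
  assumes "l < N"
  shows "holomorphic_in N (topspace (complex_space N)) (h_monom l a)"
proof -
  have "(\<lambda>t. h_monom l a (x(k := t))) field_differentiable at (x k)" for x k
  proof (cases "k \<le> l")
    case True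
    then show ?thesis by (auto simp: h_monom_upd intro!: derivative_intros)
  next
    case False
    then show ?thesis by (auto simp: h_monom_upd_other intro!: derivative_intros)
  qed
  moreover have "continuous_map (complex_space N) euclidean (h_monom l a)"
    unfolding continuous_map_atin limitin_canonical_iff h_monom_def
    using assms by (intro ballI tendsto_intros tendsto_coordinate_atin) simp_all
  ultimately show ?thesis by (simp add: holomorphic_in_def del: topspace_product_topology)
qed

lemma generically_nonzero_h_monom:
  assumes "l < N"
  shows "generically_nonzero N U (h_monom l a)"
  unfolding generically_nonzero_def
proof (intro allI impI, elim conjE)
  fix V assume V: "openin (complex_space N) V" "V \<noteq> {}"
  then obtain p where "p \<in> V" by blast
  then obtain q where "q \<in> V" "\<forall>j\<in>{..l}. q j \<noteq> 0"
    using open_contains_nonzero_coordinates[OF V(1), of p "{..l}"] assms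
    by (auto simp: subset_eq)
  then show "\<exists>x\<in>V. h_monom l a x \<noteq> 0" using h_monom_nonzero[of l q a] by auto
qed

text \<open>Choose a generic point with \<open>i\<close>-th coordinate \<open>0\<close> near \<open>p\<close> and vary that coordinate. The
  coefficient at \<open>{..d} - {i}\<close> becomes \<open>c t / t ^ a i\<close> with \<open>c \<noteq> 0\<close>. Its value at \<open>t = 0\<close> is \<open>0\<close> by the
  convention on division, whereas for \<open>t \<rightarrow> 0\<close> it is the nonzero constant \<open>c\<close> (if \<open>a i = 1\<close>) or
  unbounded.\<close>

lemma regular_points_nonzero:
  assumes \<omega>: "\<And>I y. \<omega> I y = vol_contraction d (\<lambda>j. of_nat (lam j) * y j / h_monom l a y) I"
    and "l \<le> d" "p \<in> regular_points (Suc d) \<omega>" "i \<le> l" "0 < lam i" "0 < a i"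
  shows "p i \<noteq> 0"
proof
  assume "p i = 0"
  obtain U where U: "p \<in> U" "\<And>I. holomorphic_in (Suc d) U (\<omega> I)"
    using assms(3) by (auto simp: regular_points_def)
  obtain q where q: "q \<in> U" "\<forall>j\<in>{..<Suc d} - {i}. q j \<noteq> 0" "q i = 0"
    using open_contains_nonzero_coordinates[of "Suc d" U p "{..<Suc d} - {i}"] U \<open>p i = 0\<close>
    by (auto simp: holomorphic_in_def)
  define g where "g = (\<lambda>t. \<omega> ({..d} - {i}) (q(i := t)))"
  define c where "c = (- 1) ^ i * of_nat (lam i) / (\<Prod>j\<in>{..l} - {i}. q j ^ a j)"
  have "c \<noteq> 0" using q(2) assms by (auto simp: c_def)
  obtain b where b: "a i = Suc b" using assms(6) gr0_implies_Suc by blast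
  have g: "g t = c * t / t ^ a i" for t
    using assms by (simp add: g_def c_def \<omega> vol_contraction_coeff h_monom_upd mult_ac)
  have "g field_differentiable (at 0)"
    using U(2)[of "{..d} - {i}"] q(1,3) \<open>i \<le> l\<close> \<open>l \<le> d\<close> unfolding holomorphic_in_def g_def
    by (metis le_imp_less_Suc le_trans)
  then have "g \<midarrow>0\<rightarrow> g 0"
    using field_differentiable_imp_continuous_at continuous_within by blast
  \<comment> \<open>Multiplying by \<open>t ^ b\<close> turns both cases into the constant \<open>c\<close> having the limit \<open>0\<close>.\<close>
  then have "(\<lambda>t. t ^ b * g t) \<midarrow>0\<rightarrow> 0 ^ b * g 0"
    by (intro tendsto_intros)
  moreover have "g 0 = 0" by (simp add: g)
  moreover have "\<forall>\<^sub>F t in at 0. t ^ b * g t = c"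
    unfolding eventually_at_filter by (intro always_eventually) (simp add: g b)
  ultimately have "((\<lambda>t. c) \<longlongrightarrow> 0) (at (0 :: complex))"
    using tendsto_cong by force
  then have "c = 0" by (simp add: tendsto_const_iff)
  then show False using \<open>c \<noteq> 0\<close> by simp
qed

lemma meromorphic_form_vol_contraction:
  assumes \<omega>: "\<And>I y. \<omega> I y = vol_contraction d (\<lambda>j. of_nat (lam j) * y j / h_monom l a y) I"
    and "l \<le> d"
  shows "meromorphic_form (Suc d) d \<omega>"
  unfolding meromorphic_form_def
proof (intro allI)
  fix I
  show "if I \<subseteq> {..<Suc d} \<and> card I = d then meromorphic_fun (Suc d) (\<omega> I)
    else \<forall>x\<in>topspace (complex_space (Suc d)). \<omega> I x = 0"
  proof (cases "I \<subseteq> {..<Suc d} \<and> card I = d")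
    case True
    then have I: "I \<subseteq> {..d}" "card I = d" by (auto simp: lessThan_Suc_atMost)
    then have "card ({..d} - I) = 1" by (simp add: card_Diff_subset finite_subset)
    then obtain j where "{..d} - I = {j}" by (auto simp: card_1_singleton_iff)
    then have j: "j \<le> d" "I = {..d} - {j}" using I(1) by auto
    have "\<omega> I y = ((- 1) ^ j * of_nat (lam j)) * y j / h_monom l a y" for y
      using j by (simp add: \<omega> vol_contraction_coeff)
    moreover have "holomorphic_in (Suc d) (topspace (complex_space (Suc d)))
        (\<lambda>y. ((- 1) ^ j * of_nat (lam j)) * y j)"
      using j by (intro holomorphic_in_coordinate) simp
    moreover have "holomorphic_in (Suc d) (topspace (complex_space (Suc d))) (h_monom l a)"
      "generically_nonzero (Suc d) (topspace (complex_space (Suc d))) (h_monom l a)"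
      using \<open>l \<le> d\<close> by (auto intro!: holomorphic_in_h_monom generically_nonzero_h_monom
          simp del: topspace_product_topology)
    ultimately have "meromorphic_fun (Suc d) (\<omega> I)"
      unfolding meromorphic_fun_def by blast
    then show ?thesis using True by simp
  next
    case False
    have "I \<noteq> {..d} - {j}" if "j \<le> d" for j
    proof
      assume "I = {..d} - {j}"
      then have "I \<subseteq> {..<Suc d} \<and> card I = d" using that by auto
      then show False using False by simp
    qed
    then show ?thesis using False by (auto simp: \<omega> vol_contraction_eq_0)
  qed
qed

lemma integrating_factor_h_monom:
  assumes "l \<le> d" "\<And>i. i \<le> l \<Longrightarrow> 0 < lam i" "\<And>i. i \<le> l \<Longrightarrow> 0 < a i"
    and "(\<Sum>j\<le>l. a j * lam j) = (\<Sum>j\<le>d. lam j)"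
  shows "integrating_factor (Suc d) d (Omega_form d lam) (h_monom l a)"
proof -
  let ?\<omega> = "Omega_form d lam /\<^sub>f h_monom l a"
  have \<omega>: "?\<omega> I y = vol_contraction d (\<lambda>j. of_nat (lam j) * y j / h_monom l a y) I" for I y
    by (simp add: fdivide_def Omega_form_eq vol_contraction_def sum_divide_distrib)
  have nz: "x j \<noteq> 0" if "x \<in> regular_points (Suc d) ?\<omega>" "j \<le> l" for x j
    using regular_points_nonzero[OF \<omega>] that assms by blast
  have closed: "ext_d (Suc d) ?\<omega> K x = 0" if "x \<in> regular_points (Suc d) ?\<omega>" for x K
    by (rule ext_d_vol_contraction[OF \<omega> nz[OF that] assms(1,4)])
  have "integrable_form (Suc d) d ?\<omega>"
    unfolding integrable_form_def
  proof (intro allI impI ballI conjI)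
    fix J x K
    assume J: "J \<subseteq> {..<Suc d} \<and> Suc (card J) = d" and x: "x \<in> regular_points (Suc d) ?\<omega>"
    show "(contract J ?\<omega> \<and>\<^sub>f ?\<omega>) K x = 0"
      using J by (intro contract_vol_contraction_wedge[OF \<omega>]) (auto simp: lessThan_Suc_atMost)
    show "(contract J ?\<omega> \<and>\<^sub>f ext_d (Suc d) ?\<omega>) K x = 0"
      using closed[OF x] by (simp add: wedge_def)
  qed
  then show ?thesis
    using closed meromorphic_form_vol_contraction[OF \<omega> assms(1)]
      generically_nonzero_h_monom[of l "Suc d"] assms(1)
    by (simp add: integrating_factor_def closed_form_def)
qed

theorem theorem2p16:
  fixes n k l :: nat and lam :: "nat \<Rightarrow> nat" and M :: "nat \<Rightarrow> nat \<Rightarrow> nat"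
  assumes "k \<le> n" and "l \<le> n - k"
    and "\<And>j. j \<le> n - k \<Longrightarrow> 0 < lam j"
    and "inj_on lam {..n - k}"
    and "strict_mono_on {..l} lam"
    and "strict_mono_on {l<..n - k} lam"
    and "\<not> resonant (lam ` {..l})"
    and "\<And>S. lam ` {..l} \<subset> S \<Longrightarrow> S \<subseteq> lam ` {..n - k} \<Longrightarrow> resonant S"
    and "Min (lam ` {..n - k}) \<in> lam ` {..l}"
    and "\<And>s. s \<in> {1..n - k - l} \<Longrightarrow>
           \<exists>m :: nat \<Rightarrow> nat. lam (l + s) = (\<Sum>j\<le>l. m j * lam j) \<and> 2 \<le> (\<Sum>j\<le>l. m j)"
    and "\<And>s. s \<in> {1..n - k - l} \<Longrightarrow> M (l + s) \<in> resonances lam l s"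
  shows "integrating_factor (n - k + 1) (n - k) (Omega_form (n - k) lam)
           (\<lambda>x. (\<Prod>j\<le>l. x j) * H_prod (n - k) l M x) \<and>
         (\<forall>x\<in>topspace (complex_space (n - k + 1)). (\<forall>j\<le>l. x j \<noteq> 0) \<longrightarrow>
           (\<forall>I. (Omega_form (n - k) lam /\<^sub>f (\<lambda>x. (\<Prod>j\<le>l. x j) * H_prod (n - k) l M x)) I x =
                (eta_NR l lam \<and>\<^sub>f
                   wedges (map (\<lambda>i. ext_d (n - k + 1) (fun_form (phi l i (M i))))
                     [l + 1..<n - k + 1])) I x))"
proof -
  define d where "d = n - k"
  \<comment> \<open>The exponents of the integrating factor as a single monomial.\<close>
  define a where "a = (\<lambda>j. Suc (\<Sum>i\<in>{l<..d}. M i j))"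
  have ld: "l \<le> d" using assms(2) by (simp add: d_def)
  have res: "(\<Sum>j\<le>l. M i j * lam j) = lam i" if "i \<in> {l<..d}" for i
  proof -
    have "i - l \<in> {1..n - k - l}" "l + (i - l) = i" using that by (auto simp: d_def)
    then show ?thesis using assms(11)[of "i - l"] by (simp add: resonances_def)
  qed
  have "(\<Sum>j\<le>l. a j * lam j) = (\<Sum>j\<le>l. lam j) + (\<Sum>j\<le>l. \<Sum>i\<in>{l<..d}. M i j * lam j)"
    by (simp add: a_def sum.distrib sum_distrib_right)
  also have "(\<Sum>j\<le>l. \<Sum>i\<in>{l<..d}. M i j * lam j) = (\<Sum>i\<in>{l<..d}. lam i)"
    by (subst sum.swap) (simp add: res)
  also have "(\<Sum>j\<le>l. lam j) + (\<Sum>i\<in>{l<..d}. lam i) = (\<Sum>j\<in>{..l} \<union> {l<..d}. lam j)"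
    by (rule sum.union_disjoint[symmetric]) auto
  also have "{..l} \<union> {l<..d} = {..d}" using ld by auto
  finally have weight: "(\<Sum>j\<le>l. a j * lam j) = (\<Sum>j\<le>d. lam j)" .
  have psi: "(\<lambda>x. (\<Prod>j\<le>l. x j) * H_prod d l M x) = h_monom l a"
    unfolding a_def by (rule ext) (rule integrating_monomial)
  have "integrating_factor (Suc d) d (Omega_form d lam) (\<lambda>x. (\<Prod>j\<le>l. x j) * H_prod d l M x)"
    unfolding psi using assms(3) ld
    by (intro integrating_factor_h_monom weight) (auto simp: d_def a_def)
  moreover have "(Omega_form d lam /\<^sub>f (\<lambda>x. (\<Prod>j\<le>l. x j) * H_prod d l M x)) I x =
      (eta_NR l lam \<and>\<^sub>f wedges (map (\<lambda>i. ext_d (Suc d) (fun_form (phi l i (M i)))) [l + 1..<d + 1])) I x"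
    if "\<forall>j\<le>l. x j \<noteq> 0" for x I
  proof -
    have "(Omega_form d lam /\<^sub>f (\<lambda>x. (\<Prod>j\<le>l. x j) * H_prod d l M x)) I x =
        vol_contraction d (\<lambda>j. of_nat (lam j) * x j / ((\<Prod>j\<le>l. x j) * H_prod d l M x)) I"
      by (simp add: fdivide_def Omega_form_eq vol_contraction_def sum_divide_distrib)
    then show ?thesis
      using eta_wedge_d_phi[of l x d M lam d I] that res ld by simp
  qed
  ultimately show ?thesis unfolding d_def by simp
qed

end
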